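(* Let $\mathcal{H}$ be a family of (finite, non-empty) edge-ordered graphs. If $\chi'_<(\mathcal{H})=\infty$, then $\mathrm{ex}_<(n,\mathcal{H})=\binom{n}{2}$ for every $n$. If $\chi'_<(\mathcal{H})=r+1<\infty$, then $$\mathrm{ex}_<(n,\mathcal{H})=\left(1-\frac1r+o(1)\right)\frac{n^2}{2},$$ where $o(1)\to 0$ as $n\to\infty$ for the fixed family $\mathcal H$.
   Context: An edge-ordered graph is a finite simple graph together with a linear order on its edge set (often given by an injective labeling $L:E\to\mathbb{R}$; only the induced order matters). Isomorphisms of edge-ordered graphs must preserve the edge order; a subgraph inherits the induced edge order. An edge-ordered graph $G$ contains $H$ if some subgraph of $G$ is isomorphic to $H$, otherwise $G$ avoids $H$; $G$ avoids a family if it avoids every member. All members of families are non-empty (have at least one edge). $\mathrm{ex}_<(n,\mathcal{H})$ is the maximum number of edges of an edge-ordered graph on $n$ vertices avoiding $\mathcal{H}$. A simple graph $G$ can avoid $\mathcal H$ if some edge-ordering of $G$ avoids $\mathcal H$. The order chromatic number $\chi'_<(\mathcal H)$ is the smallest chromatic number $\chi(G)$ of a finite simple graph $G$ that cannot avoid $\mathcal H$ (i.e. every edge-ordering of $G$ contains a member of $\mathcal H$); it is $\infty$ if every finite simple graph can avoid $\mathcal H$. *)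

theory Defs
  imports Complex_Main "HOL-Library.Extended_Nat"
begin

record 'a sgraph =
  verts :: "'a set"
  edges :: "'a set set"

definition simple_graph :: "('a, 'z) sgraph_scheme \<Rightarrow> bool" where
  "simple_graph G \<longleftrightarrow>
     finite (verts G) \<and> (\<forall>e\<in>edges G. e \<subseteq> verts G \<and> card e = 2)"

definition proper_coloring :: "('a, 'z) sgraph_scheme \<Rightarrow> nat \<Rightarrow> ('a \<Rightarrow> nat) \<Rightarrow> bool" where
  "proper_coloring G k c \<longleftrightarrow>
     c ` verts G \<subseteq> {..<k} \<and> (\<forall>u v. {u, v} \<in> edges G \<longrightarrow> c u \<noteq> c v)"

definition chromatic_number :: "('a, 'z) sgraph_scheme \<Rightarrow> nat" where
  "chromatic_number G = (LEAST k. \<exists>c. proper_coloring G k c)"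

record 'a eograph = "'a sgraph" +
  eord :: "'a set rel"

definition edge_ordered_graph :: "'a eograph \<Rightarrow> bool" where
  "edge_ordered_graph G \<longleftrightarrow> simple_graph G \<and> linear_order_on (edges G) (eord G)"

definition eo_subgraph :: "'a eograph \<Rightarrow> 'a eograph \<Rightarrow> bool" where
  "eo_subgraph K G \<longleftrightarrow>
     edge_ordered_graph K \<and> verts K \<subseteq> verts G \<and> edges K \<subseteq> edges G \<and>
     eord K = Restr (eord G) (edges K)"

definition eo_isomorphic :: "'a eograph \<Rightarrow> 'b eograph \<Rightarrow> bool" where
  "eo_isomorphic H K \<longleftrightarrow>
     (\<exists>f. bij_betw f (verts H) (verts K) \<and>
          edges K = (\<lambda>e. f ` e) ` edges H \<and>
          (\<forall>d\<in>edges H. \<forall>e\<in>edges H. (d, e) \<in> eord H \<longleftrightarrow> (f ` d, f ` e) \<in> eord K))"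

definition contains :: "'a eograph \<Rightarrow> 'b eograph \<Rightarrow> bool" where
  "contains G H \<longleftrightarrow> (\<exists>K. eo_subgraph K G \<and> eo_isomorphic H K)"

definition avoids :: "'a eograph \<Rightarrow> 'b eograph set \<Rightarrow> bool" where
  "avoids G \<H> \<longleftrightarrow> (\<forall>H\<in>\<H>. \<not> contains G H)"

definition can_avoid :: "'a sgraph \<Rightarrow> 'b eograph set \<Rightarrow> bool" where
  "can_avoid G \<H> \<longleftrightarrow>
     (\<exists>R. linear_order_on (edges G) R \<and>
          avoids \<lparr>verts = verts G, edges = edges G, eord = R\<rparr> \<H>)"

text \<open>Every finite graph is isomorphic to one with vertices in \<^typ>\<open>nat\<close>, so the
  host graphs below are taken over \<^typ>\<open>nat\<close> without loss of generality. The infimum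
  of the empty set in \<^typ>\<open>enat\<close> is \<open>\<infinity>\<close>.\<close>

definition order_chromatic_number :: "'b eograph set \<Rightarrow> enat" where
  "order_chromatic_number \<H> =
     Inf {enat (chromatic_number G) | G :: nat sgraph. simple_graph G \<and> \<not> can_avoid G \<H>}"

text \<open>If all members of \<open>\<H>\<close> have an edge, the set below contains \<open>0\<close> (from an edgeless
  graph), and it is bounded by \<open>n choose 2\<close>, so the maximum exists.\<close>

definition ex_less :: "nat \<Rightarrow> 'b eograph set \<Rightarrow> nat" where
  "ex_less n \<H> =
     Max {card (edges G) | G :: nat eograph.
            edge_ordered_graph G \<and> card (verts G) = n \<and> avoids G \<H>}"

end

theory Submission
  imports Defs
begin

text \<open>
  Lower bound: the balanced complete \<open>r\<close>-partite graph has chromatic number below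
  \<open>r + 1\<close>, so some edge-ordering of it avoids \<open>\<H>\<close>. Upper bound: fix \<open>G\<close> of chromatic number
  \<open>r + 1\<close> that cannot avoid \<open>\<H>\<close>. By the Erdos-Stone theorem a graph with
  \<open>(1 - 1/r + \<delta>) n\<^sup>2/2\<close> edges contains a complete \<open>(r+1)\<close>-partite graph with parts of size
  \<open>|V(G)|\<close>, hence a copy of \<open>G\<close>, and the edge-order inherited by that copy contains a
  member of \<open>\<H>\<close>.
\<close>

section \<open>The Erdos-Stone theorem\<close>

text \<open>Adjacency inside a part is left open. When \<open>R\<close> is irreflexive the parts are
  automatically disjoint, since a common vertex \<open>u\<close> would satisfy
  \<open>R u u\<close>.\<close>

definition complete_multipartite_in :: "('a \<Rightarrow> 'a \<Rightarrow> bool) \<Rightarrow> 'a set \<Rightarrow> nat \<Rightarrow> nat \<Rightarrow> (nat \<Rightarrow> 'a set) \<Rightarrow> bool" where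
  "complete_multipartite_in R V k t A \<longleftrightarrow>
     (\<forall>i<k. A i \<subseteq> V \<and> card (A i) = t) \<and>
     (\<forall>i<k. \<forall>j<k. i \<noteq> j \<longrightarrow> (\<forall>u\<in>A i. \<forall>v\<in>A j. R u v))"

lemma card_filter_add_not:
  "finite A \<Longrightarrow> card A = card {a\<in>A. P a} + card {a\<in>A. \<not> P a}"
  using card_Int_Diff[of A "Collect P"] by (simp add: Int_def set_diff_eq)

text \<open>
  Double counting of non-adjacent pairs between \<open>V\<close> and the parts: a vertex with fewer than \<open>t\<close>
  neighbours in some part contributes at least \<open>s - t \<ge> (1 - \<epsilon>/2) s\<close> pairs, whereas
  the degree condition allows only \<open>(1 - \<epsilon>) s |V|\<close> pairs in total. In \<open>deg\<close> the vertex
  \<open>v\<close> counts among its own non-neighbours when \<open>R\<close> is irreflexive.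
\<close>

lemma many_vertices_adjacent_to_all_parts:
  fixes R :: "'a \<Rightarrow> 'a \<Rightarrow> bool" and \<epsilon> :: real
  assumes V: "finite V" and \<epsilon>: "0 < \<epsilon>" "\<epsilon> \<le> 1" and s: "0 < s" "2 * real t \<le> \<epsilon> * real s"
    and sym: "symp R"
    and A: "\<And>i. i < k \<Longrightarrow> A i \<subseteq> V \<and> card (A i) = s"
    and deg: "\<And>v. v \<in> V \<Longrightarrow> real k * real (card {w\<in>V. \<not> R v w}) \<le> (1 - \<epsilon>) * real (card V)"
  shows "\<epsilon> / 2 * real (card V) \<le> real (card {v\<in>V. \<forall>i<k. t \<le> card {a\<in>A i. R v a}})"
proof -
  define W where "W = {v\<in>V. \<forall>i<k. t \<le> card {a\<in>A i. R v a}}"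
  define n where "n = real (card V)"
  have finA: "finite (A i)" if "i < k" for i using A[OF that] V finite_subset by blast
  have WV: "W \<subseteq> V" unfolding W_def by auto
  let ?f = "\<lambda>v. \<Sum>i<k. real (card {a\<in>A i. \<not> R v a})"
  have low: "(1 - \<epsilon>/2) * real s \<le> ?f v" if v: "v \<in> V - W" for v
  proof -
    obtain i where i: "i < k" "card {a\<in>A i. R v a} < t" using v unfolding W_def by (auto simp: not_le)
    have "card (A i) = card {a\<in>A i. R v a} + card {a\<in>A i. \<not> R v a}"
      by (rule card_filter_add_not[OF finA[OF i(1)]])
    hence "real s - real t \<le> real (card {a\<in>A i. \<not> R v a})" using A[OF i(1)] i(2) by linarith
    also have "\<dots> \<le> ?f v" using i(1) by (intro member_le_sum) auto
    finally show ?thesis using s by (simp add: algebra_simps)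
  qed
  have "real (card (V - W)) * ((1 - \<epsilon>/2) * real s) \<le> (\<Sum>v\<in>V - W. ?f v)"
    using sum_bounded_below[of "V - W" "(1 - \<epsilon>/2) * real s" ?f] low by simp
  also have "\<dots> \<le> (\<Sum>v\<in>V. ?f v)" using V by (intro sum_mono2) (auto intro: sum_nonneg)
  also have "\<dots> = (\<Sum>i<k. \<Sum>v\<in>V. real (card {a\<in>A i. \<not> R v a}))" by (rule sum.swap)
  \<comment> \<open>Counting from the side of the parts, symmetry turns the inner count into the
    number of non-neighbours of \<open>a\<close> in \<open>V\<close>, which \<open>deg\<close>
    bounds.\<close>
  also have "\<dots> = (\<Sum>i<k. \<Sum>a\<in>A i. real (card {v\<in>V. \<not> R a v}))"
  proof (rule sum.cong[OF refl])
    fix i assume "i \<in> {..<k}"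
    hence fin: "finite (A i)" using finA by auto
    have "(\<Sum>v\<in>V. card {a\<in>A i. \<not> R v a}) = (\<Sum>a\<in>A i. card {v\<in>V. \<not> R v a})"
      using sum_multicount_gen[OF V fin, of "\<lambda>v a. \<not> R v a" "\<lambda>a. card {v\<in>V. \<not> R v a}"] by simp
    moreover have "R v a = R a v" for v a using sym by (auto dest: sympD)
    ultimately have "(\<Sum>v\<in>V. card {a\<in>A i. \<not> R v a}) = (\<Sum>a\<in>A i. card {v\<in>V. \<not> R a v})" by simp
    from arg_cong[OF this, of real]
    show "(\<Sum>v\<in>V. real (card {a\<in>A i. \<not> R v a})) = (\<Sum>a\<in>A i. real (card {v\<in>V. \<not> R a v}))"
      by simp
  qed
  also have "\<dots> \<le> (1 - \<epsilon>) * n * real s"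
  \<comment> \<open>The bound from \<open>deg\<close> gets divided by \<open>k\<close>. For
    \<open>k = 0\<close> the sum is empty and \<open>\<epsilon> \<le> 1\<close> keeps the right side
    non-negative.\<close>
  proof (cases "k = 0")
    case True
    then show ?thesis using \<epsilon> by (simp add: n_def)
  next
    case False
    have "(\<Sum>a\<in>A i. real (card {v\<in>V. \<not> R a v})) \<le> real s * ((1 - \<epsilon>) * n / real k)" if i: "i < k" for i
    proof -
      have "real (card {v\<in>V. \<not> R a v}) \<le> (1 - \<epsilon>) * n / real k" if "a \<in> A i" for a
      proof -
        have "a \<in> V" using A[OF i] that by blast
        thus ?thesis using deg[of a] False by (simp add: n_def pos_le_divide_eq mult.commute)
      qed
      hence "(\<Sum>a\<in>A i. real (card {v\<in>V. \<not> R a v})) \<le> real (card (A i)) * ((1 - \<epsilon>) * n / real k)"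
        by (rule sum_bounded_above)
      thus ?thesis using A[OF i] by simp
    qed
    hence "(\<Sum>i<k. \<Sum>a\<in>A i. real (card {v\<in>V. \<not> R a v})) \<le> real (card {..<k}) * (real s * ((1 - \<epsilon>) * n / real k))"
      by (intro sum_bounded_above) auto
    also have "\<dots> = (1 - \<epsilon>) * n * real s" using False by simp
    finally show ?thesis .
  qed
  finally have "real (card (V - W)) * (1 - \<epsilon>/2) \<le> (1 - \<epsilon>) * n"
    using s(1) by (simp add: mult.assoc[symmetric])
  moreover have "real (card (V - W)) = n - real (card W)"
    using WV V by (simp add: n_def card_Diff_subset finite_subset of_nat_diff card_mono)
  ultimately have "(n - real (card W)) * (1 - \<epsilon>/2) \<le> (1 - \<epsilon>) * n" by simp
  hence "\<epsilon>/2 * n \<le> real (card W) * (1 - \<epsilon>/2)" by (simp add: field_simps)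
  also have "\<dots> \<le> real (card W)" using \<epsilon> by (simp add: mult_left_le)
  finally show ?thesis by (simp add: n_def W_def)
qed

text \<open>Induction on \<open>k\<close>, with \<open>t\<close> arbitrary because the step starts
  from \<open>Suc k\<close> parts of a larger size \<open>s\<close>. Many vertices have at least
  \<open>t\<close> neighbours in each of these parts; by pigeonhole \<open>t\<close> of them share
  their neighbourhood in the parts and form one part more.\<close>

lemma Erdos_Stone_min_degree:
  fixes \<epsilon> :: real
  assumes "0 < \<epsilon>" "\<epsilon> \<le> 1"
  shows "\<exists>n0. \<forall>(V :: 'a set) R. finite V \<longrightarrow> n0 \<le> card V \<longrightarrow> symp R \<longrightarrow>
     (\<forall>v\<in>V. real k * real (card {w\<in>V. \<not> R v w}) \<le> (1 - \<epsilon>) * real (card V)) \<longrightarrow>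
     (\<exists>A. complete_multipartite_in R V (Suc k) t A)"
proof (induction k arbitrary: t)
  case 0
  have main: "\<exists>A. complete_multipartite_in R V (Suc 0) t A" if tV: "t \<le> card V" for V :: "'a set" and R
  proof -
    obtain T where "T \<subseteq> V" "card T = t" using tV by (meson obtain_subset_with_card_n)
    hence "complete_multipartite_in R V (Suc 0) t (\<lambda>_. T)" by (simp add: complete_multipartite_in_def)
    thus ?thesis by blast
  qed
  show ?case by (intro exI[of _ t] allI impI main)
next
  case (Suc k)
  \<comment> \<open>Chosen to give \<open>2 * t \<le> \<epsilon> * s\<close>; the \<open>+ 1\<close>
    keeps \<open>s\<close> positive for \<open>t = 0\<close>.\<close>
  define s where "s = nat \<lceil>2 * real t / \<epsilon>\<rceil> + 1"
  have s0: "0 < s" by (simp add: s_def)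
  have "2 * real t / \<epsilon> \<le> real s" unfolding s_def by linarith
  hence s1: "2 * real t \<le> \<epsilon> * real s" using assms by (simp add: field_simps)
  from Suc.IH[of s] obtain n0 where n0: "\<forall>(V :: 'a set) R. finite V \<longrightarrow> n0 \<le> card V \<longrightarrow> symp R \<longrightarrow>
     (\<forall>v\<in>V. real k * real (card {w\<in>V. \<not> R v w}) \<le> (1 - \<epsilon>) * real (card V)) \<longrightarrow>
     (\<exists>A. complete_multipartite_in R V (Suc k) s A)" by (rule exE)
  \<comment> \<open>The old parts have at most \<open>Suc k * s\<close> vertices together, hence at
    most \<open>2 ^ (Suc k * s)\<close> subsets can occur as neighbourhoods. The bound
    \<open>n1\<close> forces more than \<open>m\<close> vertices into \<open>W\<close>.\<close>
  define m where "m = t * 2 ^ (Suc k * s)"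
  define n1 where "n1 = max n0 (nat \<lceil>2 * real (Suc m) / \<epsilon>\<rceil>)"
  have main: "\<exists>A. complete_multipartite_in R V (Suc (Suc k)) t A"
    if V: "finite V" "n1 \<le> card V" and sym: "symp R"
      and deg: "\<forall>v\<in>V. real (Suc k) * real (card {w\<in>V. \<not> R v w}) \<le> (1 - \<epsilon>) * real (card V)"
    for V :: "'a set" and R
  proof -
    have "real k * real (card {w\<in>V. \<not> R v w}) \<le> (1 - \<epsilon>) * real (card V)" if "v \<in> V" for v
    proof -
      have "real k * real (card {w\<in>V. \<not> R v w}) \<le> real (Suc k) * real (card {w\<in>V. \<not> R v w})"
        by (intro mult_right_mono) auto
      also have "\<dots> \<le> (1 - \<epsilon>) * real (card V)" using deg that by (rule bspec)
      finally show ?thesis .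
    qed
    moreover have "n0 \<le> card V" using V(2) by (simp add: n1_def)
    ultimately obtain A where A: "complete_multipartite_in R V (Suc k) s A"
      using n0[rule_format, OF V(1) _ sym] by metis
    have A1: "A i \<subseteq> V \<and> card (A i) = s" if "i < Suc k" for i
      using A that unfolding complete_multipartite_in_def by blast
    have A2: "R u v" if "i < Suc k" "j < Suc k" "i \<noteq> j" "u \<in> A i" "v \<in> A j" for i j u v
      using A that unfolding complete_multipartite_in_def by blast
    have finA: "finite (A i)" if "i < Suc k" for i using A1[OF that] V(1) finite_subset by blast
    define W where "W = {v\<in>V. \<forall>i<Suc k. t \<le> card {a\<in>A i. R v a}}"
    have finW: "finite W" using V by (simp add: W_def)
    have "\<epsilon> / 2 * real (card V) \<le> real (card W)"
      unfolding W_def by (rule many_vertices_adjacent_to_all_parts[OF V(1) assms s0 s1 sym A1 bspec[OF deg]])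
    moreover have "2 * real (Suc m) / \<epsilon> \<le> real (card V)" using V(2) unfolding n1_def by linarith
    hence "real (Suc m) \<le> \<epsilon> / 2 * real (card V)" using assms by (simp add: field_simps)
    ultimately have cW: "m < card W" by linarith
    define U where "U = (\<Union>i<Suc k. A i)"
    have finU: "finite U" using finA by (auto simp: U_def)
    have "card U \<le> (\<Sum>i<Suc k. card (A i))" unfolding U_def by (rule card_UN_le) simp
    also have "\<dots> = Suc k * s" using A1 by simp
    finally have cU: "card U \<le> Suc k * s" .
    \<comment> \<open>Pigeonhole: many vertices of \<open>W\<close> have the same neighbourhood \<open>B\<close> in the parts;
      \<open>t\<close> of them form the new part, and the old parts shrink to \<open>t\<close>-subsets of \<open>B\<close>.\<close>
    define S where "S B = {w\<in>W. {a\<in>U. R w a} = B}" for B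
    have "\<exists>B. t \<le> card (S B)"
    proof (rule ccontr)
      assume "\<not> ?thesis"
      hence small: "card (S B) \<le> t" for B by (auto simp: not_le intro: less_imp_le)
      have "W = (\<Union>B\<in>Pow U. S B)"
      proof
        show "W \<subseteq> (\<Union>B\<in>Pow U. S B)"
        proof
          fix w assume "w \<in> W"
          hence "w \<in> S {a\<in>U. R w a}" by (simp add: S_def)
          moreover have "{a\<in>U. R w a} \<in> Pow U" by blast
          ultimately show "w \<in> (\<Union>B\<in>Pow U. S B)" by (rule UN_I[rotated])
        qed
      qed (auto simp: S_def)
      hence "card W = card (\<Union>B\<in>Pow U. S B)" by (rule arg_cong)
      also have "\<dots> \<le> (\<Sum>B\<in>Pow U. card (S B))" using finU by (intro card_UN_le) simp
      also have "\<dots> \<le> card (Pow U) * t"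
        using sum_bounded_above[of "Pow U" "\<lambda>B. card (S B)" t] small by simp
      also have "\<dots> \<le> m" using cU finU by (simp add: m_def card_Pow)
      finally show False using cW by simp
    qed
    then obtain B where B: "t \<le> card (S B)" by blast
    show ?thesis
    \<comment> \<open>For \<open>t > 0\<close> the new part contains a vertex \<open>w\<close>, from
      which the shrunken old parts are read off; for \<open>t = 0\<close> empty parts
      suffice.\<close>
    proof (cases "t = 0")
      case True
      have "complete_multipartite_in R V (Suc (Suc k)) t (\<lambda>_. {})" using True by (simp add: complete_multipartite_in_def)
      thus ?thesis by blast
    next
      case False
      obtain T where T: "T \<subseteq> S B" "card T = t" using B by (meson obtain_subset_with_card_n)
      obtain w where w: "w \<in> T" using T False by fastforce
      \<comment> \<open>The neighbourhood of \<open>w\<close> in \<open>U\<close> is exactly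
        \<open>B\<close>, and membership in \<open>W\<close> gives \<open>w\<close> at least
        \<open>t\<close> neighbours in \<open>A i\<close>.\<close>
      have "\<exists>C \<subseteq> B \<inter> A i. card C = t" if i: "i < Suc k" for i
      proof -
        have "{a\<in>A i. R w a} \<subseteq> B \<inter> A i" using w T i by (auto simp: U_def S_def)
        hence "card {a\<in>A i. R w a} \<le> card (B \<inter> A i)" using finA[OF i] by (intro card_mono) auto
        moreover have "t \<le> card {a\<in>A i. R w a}" using w T i by (auto simp: W_def S_def)
        ultimately have "t \<le> card (B \<inter> A i)" by simp
        thus ?thesis by (meson obtain_subset_with_card_n)
      qed
      then obtain C where C: "\<And>i. i < Suc k \<Longrightarrow> C i \<subseteq> B \<inter> A i \<and> card (C i) = t" by metis
      define D where "D i = (if i < Suc k then C i else T)" for i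
      have TR: "R u v" if "u \<in> T" "i < Suc k" "v \<in> C i" for u v i
        using that T(1) C[of i] by (auto simp: S_def)
      have "R u v" if ij: "i < Suc (Suc k)" "j < Suc (Suc k)" "i \<noteq> j" "u \<in> D i" "v \<in> D j" for i j u v
      proof -
        consider "i < Suc k" "j < Suc k" | "i < Suc k" "\<not> j < Suc k" | "\<not> i < Suc k" "j < Suc k"
          using ij by linarith
        thus ?thesis
        proof cases
          case 1
          then show ?thesis using ij C[of i] C[of j] A2[of i j u v] by (auto simp: D_def)
        next
          case 2
          then show ?thesis using ij TR[of v i u] sym by (auto simp: D_def dest: sympD)
        next
          case 3
          then show ?thesis using ij TR[of u j v] by (auto simp: D_def)
        qed
      qed
      moreover have "D i \<subseteq> V \<and> card (D i) = t" for i
      proof (cases "i < Suc k")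
        case True
        thus ?thesis using C[OF True] A1[OF True] by (auto simp: D_def)
      next
        case False
        thus ?thesis using T by (auto simp: D_def W_def S_def)
      qed
      ultimately have "complete_multipartite_in R V (Suc (Suc k)) t D"
        unfolding complete_multipartite_in_def by blast
      thus ?thesis by blast
    qed
  qed
  show ?case by (intro exI[of _ n1] allI impI main)
qed

section \<open>From average degree to minimum degree\<close>

text \<open>
  Vertices of degree below \<open>c |V|\<close> are deleted one at a time; the hypothesis is preserved because
  \<open>c n (n + 1)\<close> drops by exactly \<open>2 c n\<close>, and the term \<open>M\<^sup>2\<close> stops the deletion before
  fewer than \<open>M\<close> vertices remain.
\<close>

lemma subset_with_large_min_degree:
  fixes c :: real and M :: nat
  assumes "finite V" "symp R" "irreflp R" "0 \<le> c"
    and "c * real (card V) * (real (card V) + 1) + (real M)\<^sup>2 < (\<Sum>v\<in>V. real (card {w\<in>V. R v w}))"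
  shows "\<exists>U\<subseteq>V. M \<le> card U \<and> (\<forall>v\<in>U. c * real (card U) \<le> real (card {w\<in>U. R v w}))"
  using assms(1,5)
proof (induction "card V" arbitrary: V)
  case 0
  then show ?case by (simp add: power2_eq_square)
next
  case (Suc n)
  let ?d = "\<lambda>V v. real (card {w\<in>V. R v w})"
  have "M \<le> card V"
  \<comment> \<open>With fewer than \<open>M\<close> vertices the degree sum would be at most
    \<open>(real M)\<^sup>2\<close>, against the hypothesis.\<close>
  proof (rule ccontr)
    assume "\<not> M \<le> card V"
    hence "card V * card V \<le> M * M" by (intro mult_le_mono) auto
    hence "real (card V) * real (card V) \<le> real M * real M" by (metis of_nat_le_iff of_nat_mult)
    moreover have "(\<Sum>v\<in>V. ?d V v) \<le> real (card V) * real (card V)"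
      using Suc.prems(1) by (intro sum_bounded_above) (auto intro: card_mono)
    moreover have "0 \<le> c * real (card V) * (real (card V) + 1)" using assms(4) by simp
    ultimately show False using Suc.prems(2) by (simp add: power2_eq_square)
  qed
  show ?case
  proof (cases "\<forall>v\<in>V. c * real (card V) \<le> ?d V v")
    case True
    then show ?thesis using \<open>M \<le> card V\<close> by blast
  next
    case False
    then obtain x where x: "x \<in> V" "?d V x < c * real (card V)" by (auto simp: not_le)
    define V' where "V' = V - {x}"
    have fin': "finite V'" and n: "card V' = n" using Suc.prems Suc.hyps(2) x by (auto simp: V'_def)
    have cV: "real (card V) = real n + 1" using Suc.hyps(2) by simp
    have step: "?d V v = ?d V' v + (if R v x then 1 else 0)" if "v \<in> V'" for v
    proof (cases "R v x")
      case True
      have "{w\<in>V. R v w} = insert x {w\<in>V'. R v w}" using True x by (auto simp: V'_def)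
      moreover have "x \<notin> {w\<in>V'. R v w}" by (simp add: V'_def)
      ultimately show ?thesis using True fin' by simp
    next
      case False
      hence "{w\<in>V. R v w} = {w\<in>V'. R v w}" by (auto simp: V'_def)
      thus ?thesis using False by simp
    qed
    \<comment> \<open>Deleting \<open>x\<close> removes its own degree from the sum and lowers the
      degree of each of its neighbours by one, so the sum falls by twice the degree of
      \<open>x\<close>.\<close>
    have "{w\<in>V'. R w x} = {w\<in>V. R x w}"
      using assms(2,3) by (auto simp: V'_def irreflp_def dest: sympD)
    hence "(\<Sum>v\<in>V'. if R v x then 1 else 0) = ?d V x"
      using fin' by (simp add: sum.If_cases Int_def)
    hence "(\<Sum>v\<in>V'. ?d V v) = (\<Sum>v\<in>V'. ?d V' v) + ?d V x" using step by (simp add: sum.distrib)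
    moreover have "(\<Sum>v\<in>V. ?d V v) = ?d V x + (\<Sum>v\<in>V'. ?d V v)"
      unfolding V'_def using x(1) Suc.prems(1) by (rule sum.remove[rotated])
    ultimately have "(\<Sum>v\<in>V. ?d V v) = (\<Sum>v\<in>V'. ?d V' v) + 2 * ?d V x" by simp
    hence "c * real (card V') * (real (card V') + 1) + (real M)\<^sup>2 < (\<Sum>v\<in>V'. ?d V' v)"
      using Suc.prems(2) x(2) unfolding n cV by (simp add: algebra_simps)
    from Suc.hyps(1)[OF n[symmetric] fin' this] show ?thesis unfolding V'_def by blast
  qed
qed

text \<open>Edge density is expressed by the degree sum, which is twice the number of edges. A large
  subset \<open>U\<close> has minimum degree at least \<open>c * card U\<close>, so each of its
  vertices has at most \<open>(1 / r - \<epsilon> / 2) * card U\<close> non-neighbours in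
  \<open>U\<close>, and the minimum degree version applies there.\<close>

theorem Erdos_Stone:
  fixes \<epsilon> :: real
  assumes r: "1 \<le> r" and \<epsilon>: "0 < \<epsilon>"
  shows "\<exists>n0. \<forall>(V :: 'a set) R. finite V \<longrightarrow> n0 \<le> card V \<longrightarrow> symp R \<longrightarrow> irreflp R \<longrightarrow>
     (1 - 1 / real r + \<epsilon>) * (real (card V))\<^sup>2 \<le> (\<Sum>v\<in>V. real (card {w\<in>V. R v w})) \<longrightarrow>
     (\<exists>A. complete_multipartite_in R V (Suc r) t A)"
proof -
  \<comment> \<open>Half of \<open>\<epsilon>\<close> remains as surplus in the minimum degree; the
    other half pays for the lower-order terms of
    \<open>subset_with_large_min_degree\<close>.\<close>
  define c where "c = 1 - 1 / real r + \<epsilon> / 2"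
  have "1 / real r \<le> 1" using r by simp
  hence c0: "0 < c" using \<epsilon> unfolding c_def by linarith
  \<comment> \<open>The minimum degree version requires a parameter at most \<open>1\<close>;
    \<open>r \<ge> 1\<close> makes \<open>\<delta>\<close> at most the available slack
    \<open>r * \<epsilon> / 2\<close>.\<close>
  define \<delta> where "\<delta> = min 1 (\<epsilon> / 2)"
  have \<delta>: "0 < \<delta>" "\<delta> \<le> 1" using \<epsilon> by (auto simp: \<delta>_def)
  from Erdos_Stone_min_degree[OF \<delta>, of r t]
  obtain M where M: "\<forall>(V :: 'a set) R. finite V \<longrightarrow> M \<le> card V \<longrightarrow> symp R \<longrightarrow>
     (\<forall>v\<in>V. real r * real (card {w\<in>V. \<not> R v w}) \<le> (1 - \<delta>) * real (card V)) \<longrightarrow>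
     (\<exists>A. complete_multipartite_in R V (Suc r) t A)" by (rule exE)
  \<comment> \<open>Ensures \<open>c + (real M)\<^sup>2 < \<epsilon> / 2 * n\<close> and
    \<open>1 \<le> n\<close> for the number \<open>n\<close> of vertices.\<close>
  define n0 where "n0 = nat \<lceil>(c + (real M)\<^sup>2) / (\<epsilon> / 2)\<rceil> + 1"
  have main: "\<exists>A. complete_multipartite_in R V (Suc r) t A"
    if V: "finite V" "n0 \<le> card V" and R: "symp R" "irreflp R"
      and e: "(1 - 1 / real r + \<epsilon>) * (real (card V))\<^sup>2 \<le> (\<Sum>v\<in>V. real (card {w\<in>V. R v w}))"
    for V :: "'a set" and R
  proof -
    define n where "n = real (card V)"
    have n1: "1 \<le> n" using V(2) by (simp add: n_def n0_def)
    have "(c + (real M)\<^sup>2) / (\<epsilon> / 2) < n" using V(2) unfolding n_def n0_def by linarith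
    hence "c + (real M)\<^sup>2 < \<epsilon> / 2 * n" using \<epsilon> by (simp add: field_simps)
    hence "(c + (real M)\<^sup>2) * n < \<epsilon> / 2 * n * n" using n1 by (intro mult_strict_right_mono) auto
    moreover have "(real M)\<^sup>2 \<le> (real M)\<^sup>2 * n" using n1 by (simp add: mult_le_cancel_left1)
    ultimately have "c * n * (n + 1) + (real M)\<^sup>2 < c * n * n + \<epsilon> / 2 * n * n"
      by (simp add: algebra_simps)
    also have "\<dots> = (1 - 1 / real r + \<epsilon>) * n\<^sup>2" by (simp add: c_def power2_eq_square algebra_simps)
    finally have "c * n * (n + 1) + (real M)\<^sup>2 < (\<Sum>v\<in>V. real (card {w\<in>V. R v w}))"
      using e by (simp add: n_def)
    from subset_with_large_min_degree[OF V(1) R less_imp_le[OF c0] this[unfolded n_def]]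
    obtain U where U: "U \<subseteq> V" "M \<le> card U" "\<forall>v\<in>U. c * real (card U) \<le> real (card {w\<in>U. R v w})"
      by (elim exE conjE) blast
    have finU: "finite U" using U(1) V(1) finite_subset by blast
    have "real r * real (card {w\<in>U. \<not> R v w}) \<le> (1 - \<delta>) * real (card U)" if v: "v \<in> U" for v
    proof -
      have "card U = card {w\<in>U. R v w} + card {w\<in>U. \<not> R v w}"
        by (rule card_filter_add_not[OF finU])
      hence "real (card {w\<in>U. \<not> R v w}) \<le> (1 - c) * real (card U)" using bspec[OF U(3) v] by (simp add: algebra_simps)
      hence "real r * real (card {w\<in>U. \<not> R v w}) \<le> real r * ((1 - c) * real (card U))"
        by (intro mult_left_mono) auto
      also have "\<dots> = (1 - real r * (\<epsilon> / 2)) * real (card U)" using r by (simp add: c_def field_simps)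
      also have "\<dots> \<le> (1 - \<delta>) * real (card U)"
      proof (intro mult_right_mono)
        have "1 * (\<epsilon> / 2) \<le> real r * (\<epsilon> / 2)" using r \<epsilon> by (intro mult_right_mono) auto
        thus "1 - real r * (\<epsilon> / 2) \<le> 1 - \<delta>" by (simp add: \<delta>_def min_def)
      qed simp
      finally show ?thesis .
    qed
    then obtain A where "complete_multipartite_in R U (Suc r) t A"
      using M[rule_format, OF finU U(2) R(1)] by metis
    hence "complete_multipartite_in R V (Suc r) t A"
      using U(1) unfolding complete_multipartite_in_def by (meson subset_trans)
    thus ?thesis by blast
  qed
  show ?thesis by (intro exI[of _ n0] allI impI main)
qed

section \<open>Edge-ordered graphs and containment\<close>

lemma simple_graph_finite_edges: "simple_graph G \<Longrightarrow> finite (edges G)"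
  unfolding simple_graph_def by (meson finite_Pow_iff finite_subset PowI subsetI)

lemma card_edges_le_choose:
  assumes "simple_graph G"
  shows "card (edges G) \<le> card (verts G) choose 2"
proof -
  have "edges G \<subseteq> {e. e \<subseteq> verts G \<and> card e = 2}" using assms by (auto simp: simple_graph_def)
  moreover have "finite (verts G)" using assms by (simp add: simple_graph_def)
  ultimately have "card (edges G) \<le> card {e. e \<subseteq> verts G \<and> card e = 2}" by (intro card_mono) auto
  thus ?thesis using n_subsets[OF \<open>finite (verts G)\<close>] by simp
qed

lemma handshake:
  assumes "simple_graph G"
  shows "(\<Sum>v\<in>verts G. card {w\<in>verts G. {v, w} \<in> edges G}) = 2 * card (edges G)"
proof -
  have fin: "finite (verts G)" using assms by (simp add: simple_graph_def)
  have E: "e \<subseteq> verts G" "card e = 2" if "e \<in> edges G" for e using assms that by (auto simp: simple_graph_def)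
  have bij: "card {w\<in>verts G. {v, w} \<in> edges G} = card {e\<in>edges G. v \<in> e}" for v
  proof (rule bij_betw_same_card[of "\<lambda>w. {v, w}"], unfold bij_betw_def, intro conjI)
    show "inj_on (\<lambda>w. {v, w}) {w\<in>verts G. {v, w} \<in> edges G}" by (auto simp: inj_on_def doubleton_eq_iff)
    show "(\<lambda>w. {v, w}) ` {w\<in>verts G. {v, w} \<in> edges G} = {e\<in>edges G. v \<in> e}"
    proof
      show "{e\<in>edges G. v \<in> e} \<subseteq> (\<lambda>w. {v, w}) ` {w\<in>verts G. {v, w} \<in> edges G}"
      proof
        fix e assume e: "e \<in> {e\<in>edges G. v \<in> e}"
        then obtain a b where ab: "e = {a, b}" using E(2) by (metis (lifting) card_2_iff mem_Collect_eq)
        show "e \<in> (\<lambda>w. {v, w}) ` {w\<in>verts G. {v, w} \<in> edges G}"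
        proof (cases "v = a")
          case True
          then show ?thesis using e ab E(1)[of e] by auto
        next
          case False
          hence "v = b" "e = {v, a}" using e ab by auto
          then show ?thesis using e E(1)[of e] by auto
        qed
      qed
    qed auto
  qed
  have "(\<Sum>v\<in>verts G. card {e\<in>edges G. v \<in> e}) = 2 * card (edges G)"
  proof (rule sum_multicount[OF fin simple_graph_finite_edges[OF assms]], intro ballI)
    fix e assume "e \<in> edges G"
    hence "{v\<in>verts G. v \<in> e} = e" "card e = 2" using E by auto
    thus "card {v\<in>verts G. v \<in> e} = 2" by simp
  qed
  thus ?thesis using bij by simp
qed

section \<open>Pulling back edge orders and transporting copies\<close>

text \<open>Injectivity carries antisymmetry and totality back to \<open>A\<close>. It serves to
  pull the edge order of a host graph back along an embedding.\<close>

lemma linear_order_on_inv_image: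
  assumes lin: "linear_order_on B S" and inj: "inj_on f A" and im: "f ` A \<subseteq> B"
  shows "linear_order_on A {(x, y). x \<in> A \<and> y \<in> A \<and> (f x, f y) \<in> S}"
proof -
  let ?T = "{(x, y). x \<in> A \<and> y \<in> A \<and> (f x, f y) \<in> S}"
  have S: "refl_on B S" "trans S" "antisym S" "total_on B S"
    using lin by (auto simp: order_on_defs)
  have fB: "f x \<in> B" if "x \<in> A" for x using im that by blast
  have "?T \<subseteq> A \<times> A" by auto
  moreover have "refl_on A ?T" using S(1) fB by (simp add: refl_on_def)
  moreover have "trans ?T" using S(2) by (auto intro!: transI dest: transD)
  moreover have "antisym ?T"
  proof (rule antisymI)
    fix x y assume "(x, y) \<in> ?T" "(y, x) \<in> ?T"
    hence xy: "x \<in> A" "y \<in> A" "(f x, f y) \<in> S" "(f y, f x) \<in> S" by auto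
    hence "f x = f y" using S(3) by (blast dest: antisymD)
    thus "x = y" using inj xy by (blast dest: inj_onD)
  qed
  moreover have "total_on A ?T"
  proof (rule total_onI)
    fix x y assume xy: "x \<in> A" "y \<in> A" "x \<noteq> y"
    hence "f x \<noteq> f y" using inj by (blast dest: inj_onD)
    hence "(f x, f y) \<in> S \<or> (f y, f x) \<in> S" using S(4) fB xy by (simp add: total_on_def)
    thus "(x, y) \<in> ?T \<or> (y, x) \<in> ?T" using xy by simp
  qed
  ultimately show ?thesis by (simp add: order_on_defs)
qed

lemma linear_order_on_Restr:
  assumes "linear_order_on B S" "A \<subseteq> B"
  shows "linear_order_on A (Restr S A)"
proof -
  have "Restr S A = {(x, y). x \<in> A \<and> y \<in> A \<and> (id x, id y) \<in> S}" by auto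
  thus ?thesis using linear_order_on_inv_image[OF assms(1), of id A] assms(2) by simp
qed

text \<open>The image under \<open>f\<close> of a copy of \<open>H\<close> in \<open>G\<close> is a
  copy in \<open>G'\<close>: since the order of \<open>G\<close> is pulled back from
  \<open>G'\<close>, composing the isomorphism onto the first copy with \<open>f\<close> preserves
  the edge order.\<close>

lemma contains_image:
  fixes G :: "'a eograph" and G' :: "'b eograph" and H :: "'c eograph"
  assumes G': "edge_ordered_graph G'" and f: "inj_on f (verts G)" "f ` verts G \<subseteq> verts G'"
    and G: "simple_graph G"
    and fe: "\<And>e. e \<in> edges G \<Longrightarrow> f ` e \<in> edges G'"
    and ord: "eord G = {(d, e). d \<in> edges G \<and> e \<in> edges G \<and> (f ` d, f ` e) \<in> eord G'}"
    and con: "contains G H"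
  shows "contains G' H"
proof -
  obtain K where K: "eo_subgraph K G" and iso: "eo_isomorphic H K"
    using con by (auto simp: contains_def)
  from iso[unfolded eo_isomorphic_def]
  obtain h where h: "bij_betw h (verts H) (verts K)" "edges K = (\<lambda>e. h ` e) ` edges H"
      "\<forall>d\<in>edges H. \<forall>e\<in>edges H. (d, e) \<in> eord H \<longleftrightarrow> (h ` d, h ` e) \<in> eord K"
    by (elim exE conjE) blast
  have KV: "verts K \<subseteq> verts G" and KE: "edges K \<subseteq> edges G" and KO: "eord K = Restr (eord G) (edges K)"
    and KS: "simple_graph K"
    using K by (auto simp: eo_subgraph_def edge_ordered_graph_def)
  define E' where "E' = (\<lambda>e. f ` e) ` edges K"
  define K' where "K' = \<lparr>verts = f ` verts K, edges = E', eord = Restr (eord G') E'\<rparr>"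
  have E'G': "E' \<subseteq> edges G'" using fe KE by (auto simp: E'_def)
  have injK: "inj_on f (verts K)" using f(1) KV by (rule inj_on_subset)
  have KEV: "e \<subseteq> verts K" "card e = 2" if "e \<in> edges K" for e
    using KS that by (auto simp: simple_graph_def)
  have "simple_graph K'"
    unfolding simple_graph_def
  proof (intro conjI ballI)
    show "finite (verts K')" using KS by (simp add: K'_def simple_graph_def)
    fix e assume "e \<in> edges K'"
    then obtain d where d: "d \<in> edges K" "e = f ` d" by (auto simp: K'_def E'_def)
    show "e \<subseteq> verts K'" using d KEV(1) by (auto simp: K'_def)
    show "card e = 2" using d KEV[OF d(1)] injK by (metis card_image inj_on_subset)
  qed
  moreover have "linear_order_on E' (Restr (eord G') E')"
    using G' E'G' linear_order_on_Restr by (auto simp: edge_ordered_graph_def)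
  ultimately have "edge_ordered_graph K'" by (simp add: edge_ordered_graph_def K'_def)
  moreover have "f ` verts K \<subseteq> verts G'" using f(2) KV by blast
  ultimately have sub: "eo_subgraph K' G'"
    using E'G' by (simp add: eo_subgraph_def K'_def)
  have "eo_isomorphic H K'"
    unfolding eo_isomorphic_def
  proof (intro exI[of _ "f \<circ> h"] conjI ballI)
    have "bij_betw f (verts K) (verts K')" using injK by (simp add: K'_def bij_betw_def)
    with h(1) show "bij_betw (f \<circ> h) (verts H) (verts K')" by (rule bij_betw_trans)
    show "edges K' = (\<lambda>e. (f \<circ> h) ` e) ` edges H"
      by (simp add: K'_def E'_def h(2) image_image o_def)
    fix d e assume de: "d \<in> edges H" "e \<in> edges H"
    hence in_K: "h ` d \<in> edges K" "h ` e \<in> edges K" using h(2) by auto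
    have "(d, e) \<in> eord H \<longleftrightarrow> (h ` d, h ` e) \<in> eord K" using h(3) de by blast
    also have "\<dots> \<longleftrightarrow> (f ` h ` d, f ` h ` e) \<in> eord G'"
      using in_K subsetD[OF KE in_K(1)] subsetD[OF KE in_K(2)] by (simp add: KO ord)
    also have "\<dots> \<longleftrightarrow> ((f \<circ> h) ` d, (f \<circ> h) ` e) \<in> eord K'"
      using imageI[OF in_K(1), of "\<lambda>e. f ` e"] imageI[OF in_K(2), of "\<lambda>e. f ` e"]
      by (simp add: K'_def E'_def[symmetric] image_comp)
    finally show "(d, e) \<in> eord H \<longleftrightarrow> ((f \<circ> h) ` d, (f \<circ> h) ` e) \<in> eord K'" .
  qed
  with sub show ?thesis unfolding contains_def by blast
qed

section \<open>Colourings and embeddings into complete multipartite graphs\<close>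

text \<open>The least number of colours is attained because some number works: an injective
  numbering of the vertices is proper, as every edge has two distinct ends.\<close>

lemma chromatic_number_coloring:
  assumes "simple_graph G"
  shows "\<exists>c. proper_coloring G (chromatic_number G) c"
  unfolding chromatic_number_def
proof (rule LeastI_ex)
  have "finite (verts G)" using assms by (simp add: simple_graph_def)
  then obtain c where c: "bij_betw c (verts G) {..<card (verts G)}"
    using ex_bij_betw_finite_nat by (metis atLeast0LessThan)
  have "c u \<noteq> c v" if "{u, v} \<in> edges G" for u v
  proof -
    have "card {u, v} = 2" "{u, v} \<subseteq> verts G" using assms that by (auto simp: simple_graph_def)
    hence "u \<noteq> v" "u \<in> verts G" "v \<in> verts G" by auto
    thus ?thesis using c by (metis bij_betw_imp_inj_on inj_onD)
  qed
  hence "proper_coloring G (card (verts G)) c" using c by (auto simp: proper_coloring_def bij_betw_def)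
  thus "\<exists>k c. proper_coloring G k c" by blast
qed

text \<open>Sending colour class \<open>i\<close> of \<open>G\<close> injectively into
  \<open>A i\<close> embeds \<open>G\<close> in \<open>G'\<close>. The edge order pulled back to
  \<open>G\<close> must produce a member of the family, and \<open>contains_image\<close> moves it
  to \<open>G'\<close>.\<close>

lemma not_avoids_if_multipartite:
  fixes G :: "'a sgraph" and G' :: "'b eograph" and \<H> :: "'c eograph set"
  assumes G': "edge_ordered_graph G'" and G: "simple_graph G" "\<not> can_avoid G \<H>"
    and c: "proper_coloring G k c"
    and A: "complete_multipartite_in (\<lambda>u v. {u, v} \<in> edges G') (verts G') k (card (verts G)) A"
  shows "\<not> avoids G' \<H>"
proof -
  have fin: "finite (verts G)" using G by (simp add: simple_graph_def)
  have finG': "finite (verts G')" using G' by (simp add: simple_graph_def edge_ordered_graph_def)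
  have A1: "A i \<subseteq> verts G' \<and> card (A i) = card (verts G)" if "i < k" for i
    using A that by (simp add: complete_multipartite_in_def)
  have A2: "{u, v} \<in> edges G'" if "i < k" "j < k" "i \<noteq> j" "u \<in> A i" "v \<in> A j" for i j u v
    using A that by (auto simp: complete_multipartite_in_def)
  \<comment> \<open>Each part is as large as all of \<open>verts G\<close>, so one bijection per
    part serves its colour class whatever the size of that class.\<close>
  have "\<exists>g. bij_betw g (verts G) (A i)" if "i < k" for i
    using A1[OF that] fin finG' by (metis finite_same_card_bij finite_subset)
  then obtain g where g: "\<And>i. i < k \<Longrightarrow> bij_betw (g i) (verts G) (A i)" by metis
  define f where "f v = g (c v) v" for v
  have ck: "c v < k" if "v \<in> verts G" for v using c that by (auto simp: proper_coloring_def)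
  have fA: "f v \<in> A (c v)" if "v \<in> verts G" for v
    using g[OF ck[OF that]] that by (auto simp: f_def bij_betw_def)
  have adj: "{f u, f v} \<in> edges G'" if "u \<in> verts G" "v \<in> verts G" "c u \<noteq> c v" for u v
    using A2 ck fA that by blast
  have E2: "card e = 2" if "e \<in> edges G'" for e
    using G' that by (simp add: simple_graph_def edge_ordered_graph_def)
  \<comment> \<open>Vertices of different colours have adjacent, hence distinct, images; within one
    colour \<open>f\<close> agrees with a single bijection.\<close>
  have inj: "inj_on f (verts G)"
  proof (rule inj_onI)
    fix u v assume uv: "u \<in> verts G" "v \<in> verts G" "f u = f v"
    have "c u = c v"
    proof (rule ccontr)
      assume "c u \<noteq> c v"
      hence "card {f u, f v} = 2" using adj E2 uv by blast
      thus False using uv by simp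
    qed
    thus "u = v" using uv g[OF ck[OF uv(1)]] by (auto simp: f_def bij_betw_def dest: inj_onD)
  qed
  have im: "f ` verts G \<subseteq> verts G'" using fA A1 ck by blast
  have Gsub: "e \<subseteq> verts G" if "e \<in> edges G" for e using G that by (auto simp: simple_graph_def)
  have fe: "f ` e \<in> edges G'" if e: "e \<in> edges G" for e
  proof -
    obtain u v where uv: "e = {u, v}" using G e by (metis simple_graph_def card_2_iff)
    hence "c u \<noteq> c v" using c e by (auto simp: proper_coloring_def)
    thus ?thesis using adj[of u v] Gsub[OF e] uv by simp
  qed
  define S where "S = {(d, e). d \<in> edges G \<and> e \<in> edges G \<and> (f ` d, f ` e) \<in> eord G'}"
  have "inj_on (\<lambda>e. f ` e) (edges G)"
    using inj Gsub by (auto simp: inj_on_def[of "\<lambda>e. f ` e"] inj_on_image_eq_iff)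
  hence lin: "linear_order_on (edges G) S"
    unfolding S_def using G' fe
    by (intro linear_order_on_inv_image[where B = "edges G'"]) (auto simp: edge_ordered_graph_def)
  define G1 where "G1 = \<lparr>verts = verts G, edges = edges G, eord = S\<rparr>"
  have "\<not> avoids G1 \<H>" using G(2) lin unfolding can_avoid_def G1_def by blast
  then obtain H where H: "H \<in> \<H>" "contains G1 H" unfolding avoids_def by blast
  have "contains G' H"
    using G' inj im fe G(1)
    by (intro contains_image[OF G' _ _ _ _ _ H(2), of f]) (auto simp: G1_def S_def simple_graph_def)
  thus ?thesis using H(1) unfolding avoids_def by blast
qed

text \<open>A copy of a graph with an edge has an edge itself. This makes the set under the maximum
  in \<open>ex_less\<close> non-empty and excludes order chromatic number \<open>1\<close>.\<close>

lemma edgeless_avoids: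
  fixes G :: "'a eograph" and \<H> :: "'b eograph set"
  assumes "edges G = {}" "\<forall>H\<in>\<H>. edges H \<noteq> {}"
  shows "avoids G \<H>"
  unfolding avoids_def
proof
  fix H assume "H \<in> \<H>"
  hence "edges H \<noteq> {}" using assms(2) by blast
  have "\<not> eo_isomorphic H K" if "eo_subgraph K G" for K
  proof -
    have "edges K = {}" using that assms(1) by (simp add: eo_subgraph_def)
    thus ?thesis using \<open>edges H \<noteq> {}\<close> by (auto simp: eo_isomorphic_def)
  qed
  thus "\<not> contains G H" by (auto simp: contains_def)
qed

section \<open>Extremal numbers\<close>

lemma ex_less_set_finite:
  "finite {card (edges G) | G :: nat eograph. edge_ordered_graph G \<and> card (verts G) = n \<and> avoids G \<H>}"
  by (rule finite_subset[of _ "{..n choose 2}"])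
    (auto simp: edge_ordered_graph_def dest: card_edges_le_choose)

lemma ex_less_ge:
  fixes G :: "nat eograph"
  assumes "edge_ordered_graph G" "card (verts G) = n" "avoids G \<H>"
  shows "card (edges G) \<le> ex_less n \<H>"
  unfolding ex_less_def using assms by (intro Max_ge[OF ex_less_set_finite]) blast

lemma ex_less_attained:
  assumes "\<forall>H\<in>\<H>. edges H \<noteq> {}"
  shows "\<exists>G :: nat eograph. edge_ordered_graph G \<and> card (verts G) = n \<and> avoids G \<H> \<and>
    card (edges G) = ex_less n \<H>"
proof -
  let ?S = "{card (edges G) | G :: nat eograph. edge_ordered_graph G \<and> card (verts G) = n \<and> avoids G \<H>}"
  define G :: "nat eograph" where "G = \<lparr>verts = {..<n}, edges = {}, eord = {}\<rparr>"
  have "edge_ordered_graph G" "card (verts G) = n" "avoids G \<H>"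
    using assms edgeless_avoids[of G \<H>] by (auto simp: G_def edge_ordered_graph_def simple_graph_def)
  hence "card (edges G) \<in> ?S" by blast
  hence "ex_less n \<H> \<in> ?S" unfolding ex_less_def by (intro Max_in[OF ex_less_set_finite]) blast
  thus ?thesis by (auto simp: eq_commute)
qed

lemma ex_less_ge_can_avoid:
  fixes G :: "nat sgraph"
  assumes "simple_graph G" "can_avoid G \<H>"
  shows "card (edges G) \<le> ex_less (card (verts G)) \<H>"
proof -
  obtain S where "linear_order_on (edges G) S" "avoids \<lparr>verts = verts G, edges = edges G, eord = S\<rparr> \<H>"
    using assms(2) unfolding can_avoid_def by blast
  thus ?thesis using ex_less_ge[of "\<lparr>verts = verts G, edges = edges G, eord = S\<rparr>"] assms(1)
    by (auto simp: edge_ordered_graph_def simple_graph_def)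
qed

lemma order_chromatic_number_le:
  fixes G :: "nat sgraph"
  assumes "simple_graph G" "\<not> can_avoid G \<H>"
  shows "order_chromatic_number \<H> \<le> enat (chromatic_number G)"
  unfolding order_chromatic_number_def using assms by (intro Inf_lower) blast

text \<open>A non-empty set of extended naturals has a least element, and only the empty set could
  have been assigned \<open>\<infinity>\<close> here.\<close>

lemma order_chromatic_number_attained:
  assumes "order_chromatic_number \<H> \<noteq> \<infinity>"
  shows "\<exists>G :: nat sgraph. simple_graph G \<and> \<not> can_avoid G \<H> \<and>
    order_chromatic_number \<H> = enat (chromatic_number G)"
proof -
  let ?S = "{enat (chromatic_number G) | G :: nat sgraph. simple_graph G \<and> \<not> can_avoid G \<H>}"
  have "?S \<noteq> {}" using assms unfolding order_chromatic_number_def by (metis Inf_enat_def)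
  hence "Inf ?S \<in> ?S" by (metis (mono_tags, lifting) Inf_enat_def LeastI_ex ex_in_conv)
  thus ?thesis unfolding order_chromatic_number_def by blast
qed

text \<open>The complete graph on \<open>n\<close> vertices can avoid the family, as otherwise its
  chromatic number would be a finite upper bound.\<close>

lemma ex_less_eq_choose:
  assumes "\<forall>H\<in>\<H>. edges H \<noteq> {}" "order_chromatic_number \<H> = \<infinity>"
  shows "ex_less n \<H> = n choose 2"
proof (rule antisym)
  obtain G :: "nat eograph" where "edge_ordered_graph G" "card (verts G) = n" "card (edges G) = ex_less n \<H>"
    using ex_less_attained[OF assms(1)] by metis
  thus "ex_less n \<H> \<le> n choose 2" using card_edges_le_choose by (metis edge_ordered_graph_def)
next
  define G :: "nat sgraph" where "G = \<lparr>verts = {..<n}, edges = {e. e \<subseteq> {..<n} \<and> card e = 2}\<rparr>"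
  have sg: "simple_graph G" by (simp add: G_def simple_graph_def)
  moreover have "can_avoid G \<H>"
    using order_chromatic_number_le[OF sg, of \<H>] assms(2) by auto
  ultimately have "card (edges G) \<le> ex_less (card (verts G)) \<H>" by (rule ex_less_ge_can_avoid)
  thus "n choose 2 \<le> ex_less n \<H>" by (simp add: G_def n_subsets)
qed

section \<open>Lower bound from balanced complete multipartite graphs\<close>

text \<open>Within a residue class \<open>w\<close> is determined by \<open>w div r\<close>, which
  takes at most \<open>n div r + 1\<close> values.\<close>

lemma card_residue_class_le:
  assumes "1 \<le> r"
  shows "real (card {w \<in> {..<n}. w mod r = i}) \<le> real n / real r + 1"
proof -
  have "inj_on (\<lambda>w. w div r) {w \<in> {..<n}. w mod r = i}"
    by (rule inj_onI) (metis (mono_tags, lifting) div_mult_mod_eq mem_Collect_eq)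
  moreover have "(\<lambda>w. w div r) ` {w \<in> {..<n}. w mod r = i} \<subseteq> {..n div r}"
    by (auto intro: div_le_mono)
  ultimately have "card {w \<in> {..<n}. w mod r = i} \<le> card {..n div r}"
    by (intro card_inj_on_le) auto
  hence "real (card {w \<in> {..<n}. w mod r = i}) \<le> real (n div r) + 1" by simp
  also have "real (n div r) \<le> real n / real r" by (rule of_nat_div_le_of_nat)
  finally show ?thesis by simp
qed

text \<open>The residue classes modulo \<open>r\<close> are the parts of a complete multipartite
  graph coloured by \<open>v mod r\<close>. Each vertex misses only its own class, and summing
  degrees counts every edge twice.\<close>

lemma ex_less_lower_bound:
  assumes r: "1 \<le> r" and chi: "enat r < order_chromatic_number \<H>"
  shows "real n * (real n - real n / real r - 1) \<le> 2 * real (ex_less n \<H>)"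
proof -
  define G :: "nat sgraph" where
    "G = \<lparr>verts = {..<n}, edges = {{u, v} | u v. u < n \<and> v < n \<and> u mod r \<noteq> v mod r}\<rparr>"
  have sg: "simple_graph G" by (auto simp: G_def simple_graph_def card_insert_if)
  have adj: "{u, v} \<in> edges G \<longleftrightarrow> u < n \<and> v < n \<and> u mod r \<noteq> v mod r" for u v
  proof
    assume "{u, v} \<in> edges G"
    then obtain a b where "{u, v} = {a, b}" "a < n" "b < n" "a mod r \<noteq> b mod r" by (auto simp: G_def)
    thus "u < n \<and> v < n \<and> u mod r \<noteq> v mod r" by (metis doubleton_eq_iff)
  qed (auto simp: G_def)
  have "proper_coloring G r (\<lambda>v. v mod r)"
    using r adj by (auto simp: proper_coloring_def G_def)
  hence "chromatic_number G \<le> r" unfolding chromatic_number_def by (intro Least_le) blast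
  hence "\<not> order_chromatic_number \<H> \<le> enat (chromatic_number G)"
    using chi by (metis enat_ord_simps(1) leD order.trans)
  hence "can_avoid G \<H>" using order_chromatic_number_le[OF sg] by blast
  from ex_less_ge_can_avoid[OF sg this]
  have "card (edges G) \<le> ex_less n \<H>" by (simp add: G_def)
  moreover have "real n * (real n - real n / real r - 1) \<le> (\<Sum>v\<in>verts G. real (card {w\<in>verts G. {v, w} \<in> edges G}))"
  proof -
    have "real n - real n / real r - 1 \<le> real (card {w\<in>verts G. {v, w} \<in> edges G})" if v: "v \<in> {..<n}" for v
    proof -
      have eq: "{w\<in>verts G. {v, w} \<in> edges G} = {..<n} - {w \<in> {..<n}. w mod r = v mod r}"
        using v unfolding adj by (auto simp: G_def)
      have "real (card {..<n}) - real (card {w \<in> {..<n}. w mod r = v mod r})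
        \<le> real (card ({..<n} - {w \<in> {..<n}. w mod r = v mod r}))"
        using diff_card_le_card_Diff[of "{w \<in> {..<n}. w mod r = v mod r}" "{..<n}"] by simp
      thus ?thesis unfolding eq using card_residue_class_le[OF r, of n "v mod r"] by simp
    qed
    hence "real (card {..<n}) * (real n - real n / real r - 1) \<le> (\<Sum>v<n. real (card {w\<in>verts G. {v, w} \<in> edges G}))"
      by (rule sum_bounded_below)
    thus ?thesis by (simp add: G_def)
  qed
  moreover have "(\<Sum>v\<in>verts G. real (card {w\<in>verts G. {v, w} \<in> edges G})) = 2 * real (card (edges G))"
    using arg_cong[OF handshake[OF sg], of real] by simp
  ultimately show ?thesis by linarith
qed

section \<open>Upper bound from the Erdos-Stone theorem and the limit\<close>

lemma ex_less_upper_bound: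
  fixes \<delta> :: real
  assumes ne: "\<forall>H\<in>\<H>. edges H \<noteq> {}" and r: "1 \<le> r" and \<delta>: "0 < \<delta>"
    and chi: "order_chromatic_number \<H> = enat (r + 1)"
  shows "eventually (\<lambda>n. 2 * real (ex_less n \<H>) < (1 - 1 / real r + \<delta>) * (real n)\<^sup>2) sequentially"
proof -
  obtain G :: "nat sgraph" where G: "simple_graph G" "\<not> can_avoid G \<H>" "chromatic_number G = Suc r"
    using order_chromatic_number_attained[of \<H>] chi by auto
  obtain c where c: "proper_coloring G (Suc r) c" using chromatic_number_coloring[OF G(1)] G(3) by auto
  from Erdos_Stone[OF r \<delta>, of "card (verts G)"]
  obtain n0 where n0: "\<forall>(V :: nat set) R. finite V \<longrightarrow> n0 \<le> card V \<longrightarrow> symp R \<longrightarrow> irreflp R \<longrightarrow>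
     (1 - 1 / real r + \<delta>) * (real (card V))\<^sup>2 \<le> (\<Sum>v\<in>V. real (card {w\<in>V. R v w})) \<longrightarrow>
     (\<exists>A. complete_multipartite_in R V (Suc r) (card (verts G)) A)" by (rule exE)
  have "2 * real (ex_less n \<H>) < (1 - 1 / real r + \<delta>) * (real n)\<^sup>2" if n: "n0 \<le> n" for n
  proof (rule ccontr)
    assume "\<not> ?thesis"
    hence large: "(1 - 1 / real r + \<delta>) * (real n)\<^sup>2 \<le> 2 * real (ex_less n \<H>)" by simp
    \<comment> \<open>An extremal \<open>F\<close> has degree sum \<open>2 * ex_less n \<H>\<close>,
      so too many edges would give it a multipartite subgraph hosting \<open>G\<close>,
      contradicting avoidance.\<close>
    obtain F :: "nat eograph" where F: "edge_ordered_graph F" "card (verts F) = n" "avoids F \<H>"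
        "card (edges F) = ex_less n \<H>"
      using ex_less_attained[OF ne] by metis
    have sg: "simple_graph F" using F by (simp add: edge_ordered_graph_def)
    have "(\<Sum>v\<in>verts F. real (card {w\<in>verts F. {v, w} \<in> edges F})) = 2 * real (ex_less n \<H>)"
      using arg_cong[OF handshake[OF sg], of real] F(4) by simp
    moreover have "symp (\<lambda>u v. {u, v} \<in> edges F)" by (simp add: symp_def insert_commute)
    moreover have "irreflp (\<lambda>u v. {u, v} \<in> edges F)" using sg by (auto simp: irreflp_def simple_graph_def)
    moreover have "finite (verts F)" using sg by (simp add: simple_graph_def)
    ultimately obtain A where "complete_multipartite_in (\<lambda>u v. {u, v} \<in> edges F) (verts F) (Suc r) (card (verts G)) A"
      using n0[rule_format, of "verts F" "\<lambda>u v. {u, v} \<in> edges F"] large F(2) n by auto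
    from not_avoids_if_multipartite[OF F(1) G(1,2) c this] F(3) show False by blast
  qed
  thus ?thesis by (auto simp: eventually_sequentially)
qed

text \<open>A graph with a proper 1-colouring is edgeless and avoids the family, so
  \<open>r = 0\<close> is impossible and \<open>1 / real r\<close> is a genuine quotient.\<close>

lemma order_chromatic_number_ge_2:
  assumes ne: "\<forall>H\<in>\<H>. edges H \<noteq> {}" and chi: "order_chromatic_number \<H> = enat (r + 1)"
  shows "1 \<le> r"
proof (rule ccontr)
  assume "\<not> 1 \<le> r"
  then obtain G :: "nat sgraph" where G: "simple_graph G" "\<not> can_avoid G \<H>" "chromatic_number G = 1"
    using order_chromatic_number_attained[of \<H>] chi by (auto simp: one_enat_def)
  obtain c where c: "proper_coloring G 1 c" using chromatic_number_coloring[OF G(1)] G(3) by auto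
  have "edges G = {}"
  proof (rule ccontr)
    assume "edges G \<noteq> {}"
    then obtain u v where uv: "{u, v} \<in> edges G" using G(1) by (metis simple_graph_def card_2_iff ex_in_conv)
    hence "u \<in> verts G" "v \<in> verts G" "c u \<noteq> c v" using c G(1) by (auto simp: simple_graph_def proper_coloring_def)
    moreover have "c w = 0" if "w \<in> verts G" for w using c that by (auto simp: proper_coloring_def)
    ultimately show False by simp
  qed
  hence "avoids \<lparr>verts = verts G, edges = edges G, eord = {}\<rparr> \<H>"
    by (intro edgeless_avoids[OF _ ne]) simp
  hence "can_avoid G \<H>" unfolding can_avoid_def using \<open>edges G = {}\<close> by (intro exI[of _ "{}"]) simp
  thus False using G(2) by blast
qed

theorem theorem2p4:
  fixes \<H> :: "'a eograph set"
  assumes "\<And>H. H \<in> \<H> \<Longrightarrow> edge_ordered_graph H \<and> edges H \<noteq> {}"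
  shows "(order_chromatic_number \<H> = \<infinity> \<longrightarrow> (\<forall>n. ex_less n \<H> = n choose 2)) \<and>
    (\<forall>r::nat. order_chromatic_number \<H> = enat (r + 1) \<longrightarrow>
       (\<exists>\<epsilon> :: nat \<Rightarrow> real. \<epsilon> \<longlonglongrightarrow> 0 \<and>
          (\<forall>n. real (ex_less n \<H>) = (1 - 1 / real r + \<epsilon> n) * (real n)\<^sup>2 / 2)))"
proof (intro conjI impI allI)
  have ne: "\<forall>H\<in>\<H>. edges H \<noteq> {}" using assms by blast
  show "ex_less n \<H> = n choose 2" if "order_chromatic_number \<H> = \<infinity>" for n
    using ex_less_eq_choose[OF ne that] .
  fix r :: nat assume chi: "order_chromatic_number \<H> = enat (r + 1)"
  have r: "1 \<le> r" by (rule order_chromatic_number_ge_2[OF ne chi])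
  \<comment> \<open>The claimed identity solved for the error term; this is meaningful for
    \<open>n > 0\<close>.\<close>
  define \<epsilon> where "\<epsilon> n = 2 * real (ex_less n \<H>) / (real n)\<^sup>2 - (1 - 1 / real r)" for n
  have "\<epsilon> \<longlonglongrightarrow> 0"
  proof (rule order_tendstoI)
    fix a :: real assume a: "a < 0"
    \<comment> \<open>Dividing the lower bound by \<open>(real n)\<^sup>2\<close> gives
      \<open>\<epsilon> n \<ge> - 1 / real n\<close>.\<close>
    have "eventually (\<lambda>n. 1 / real n < - a) sequentially"
      using order_tendstoD(2)[OF lim_1_over_n, of "- a"] a by simp
    thus "eventually (\<lambda>n. a < \<epsilon> n) sequentially" using eventually_gt_at_top[of 0]
    proof eventually_elim
      case (elim n)
      have "real n * (real n - real n / real r - 1) / (real n)\<^sup>2 \<le> 2 * real (ex_less n \<H>) / (real n)\<^sup>2"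
        using ex_less_lower_bound[OF r, of \<H> n] chi by (intro divide_right_mono) auto
      moreover have "real n * (real n - real n / real r - 1) / (real n)\<^sup>2 = 1 - 1 / real r - 1 / real n"
        using elim r by (simp add: field_simps power2_eq_square)
      ultimately show ?case using elim by (simp add: \<epsilon>_def)
    qed
  next
    fix a :: real assume a: "0 < a"
    show "eventually (\<lambda>n. \<epsilon> n < a) sequentially"
      using ex_less_upper_bound[OF ne r a chi] eventually_gt_at_top[of 0]
    proof eventually_elim
      case (elim n)
      hence "2 * real (ex_less n \<H>) / (real n)\<^sup>2 < 1 - 1 / real r + a"
        by (simp add: pos_divide_less_eq)
      then show ?case by (simp add: \<epsilon>_def)
    qed
  qed
  moreover have "real (ex_less n \<H>) = (1 - 1 / real r + \<epsilon> n) * (real n)\<^sup>2 / 2" for n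
  proof (cases "n = 0")
    case True
    \<comment> \<open>At \<open>n = 0\<close> the right side vanishes whatever
      \<open>\<epsilon> 0\<close> is, so the identity reduces to
      \<open>ex_less 0 \<H> = 0\<close>.\<close>
    obtain F :: "nat eograph" where "edge_ordered_graph F" "card (verts F) = 0" "card (edges F) = ex_less 0 \<H>"
      using ex_less_attained[OF ne] by metis
    hence "ex_less 0 \<H> \<le> 0 choose 2" using card_edges_le_choose[of F] by (metis edge_ordered_graph_def)
    hence "ex_less 0 \<H> = 0" by (simp add: numeral_2_eq_2)
    thus ?thesis using True by simp
  next
    case False
    thus ?thesis by (simp add: \<epsilon>_def)
  qed
  ultimately show "\<exists>\<epsilon> :: nat \<Rightarrow> real. \<epsilon> \<longlonglongrightarrow> 0 \<and>
      (\<forall>n. real (ex_less n \<H>) = (1 - 1 / real r + \<epsilon> n) * (real n)\<^sup>2 / 2)" by blast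
qed

end
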